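(* The function $\boldsymbol W:\mathbb R_+^N\to\mathbb R_+^N$ given by $$W_i(\boldsymbol c)=c_i\left(1+\frac{\eta_i}{1+\sum_{j=1}^N b_jc_j}\right),\qquad 1\le i\le N,$$ is invertible (i.e. a bijection of $\mathbb R_+^N$ onto $\mathbb R_+^N$). The inverse function $\boldsymbol C:=\boldsymbol W^{-1}:\mathbb R_+^N\to\mathbb R_+^N$ is continuously differentiable in $\mathbb R_+^N$ and is given by $$C_i(\boldsymbol w)=\frac{w_i}{1+\eta_i/\rho_0(\boldsymbol w)},\qquad 1\le i\le N,$$ where $\rho_0(\boldsymbol w)$ is the only positive root of the rational function of the real variable $y$ $$R_{\boldsymbol w}(y)=1-y+\sum_{i=1}^N\frac{y}{y+\eta_i}\,b_iw_i .$$
   Context: Let $N\ge 1$ be an integer, $\epsilon\in(0,1)$, and let $a_i>0$, $b_i>0$ ($i=1,\dots,N$) be real constants with $0<a_1<a_2<\dots<a_N$. Put $\eta_i=\frac{1-\epsilon}{\epsilon}a_i$ for $i=1,\dots,N$. Let $\mathbb R_+^N=[0,\infty)^N$. Continuous differentiability on the closed set $\mathbb R_+^N$ is understood up to the boundary, i.e. in the sense of being the restriction of a continuously differentiable function defined on an open neighborhood of $\mathbb R_+^N$. *)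

theory Defs
  imports "HOL-Analysis.Analysis"
begin

text \<open>Indices range over a type of class \<open>finite\<close> and \<open>linorder\<close>, which stands for
  \<open>{1..N}\<close> with its usual order, where \<open>N = CARD('n) \<ge> 1\<close>.\<close>

definition orthant :: "(real^'n) set" where
  "orthant = {c. \<forall>i. 0 \<le> c $ i}"

definition eta :: "real \<Rightarrow> real^'n \<Rightarrow> real^'n" where
  "eta \<epsilon> a = (\<chi> i. (1 - \<epsilon>) / \<epsilon> * a $ i)"

definition W :: "real \<Rightarrow> real^'n \<Rightarrow> real^'n \<Rightarrow> real^'n \<Rightarrow> real^'n" where
  "W \<epsilon> a b c = (\<chi> i. c $ i * (1 + eta \<epsilon> a $ i / (1 + (\<Sum>j\<in>UNIV. b $ j * c $ j))))"

text \<open>Only used at \<open>y > 0\<close>, away from the poles \<open>- eta \<epsilon> a $ i < 0\<close>.\<close>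

definition R :: "real \<Rightarrow> real^'n \<Rightarrow> real^'n \<Rightarrow> real^'n \<Rightarrow> real \<Rightarrow> real" where
  "R \<epsilon> a b w y = 1 - y + (\<Sum>i\<in>UNIV. y / (y + eta \<epsilon> a $ i) * (b $ i * w $ i))"

definition rho0 :: "real \<Rightarrow> real^'n \<Rightarrow> real^'n \<Rightarrow> real^'n \<Rightarrow> real" where
  "rho0 \<epsilon> a b w = (THE y. 0 < y \<and> R \<epsilon> a b w y = 0)"

text \<open>Continuous differentiability up to the boundary on a set \<open>S\<close> that need not be open:
  \<open>f\<close> agrees on \<open>S\<close> with a \<open>C\<^sup>1\<close> function on an open neighbourhood of \<open>S\<close>.\<close>

definition C1_up_to_boundary ::
    "'a::real_normed_vector set \<Rightarrow> ('a \<Rightarrow> 'b::real_normed_vector) \<Rightarrow> bool" where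
  "C1_up_to_boundary S f \<longleftrightarrow>
    (\<exists>U g. \<exists>g' :: 'a \<Rightarrow> 'a \<Rightarrow>\<^sub>L 'b.
       open U \<and> S \<subseteq> U \<and>
       (\<forall>x\<in>U. (g has_derivative blinfun_apply (g' x)) (at x)) \<and>
       continuous_on U g' \<and>
       (\<forall>x\<in>S. g x = f x))"

end

theory Submission
  imports Defs
begin

text \<open>
  Write \<open>e\<close> for the vector of the \<open>\<eta>\<^sub>i\<close>. The only nonlinear ingredient of \<open>W\<close> is the scalar
  \<open>y = 1 + (\<Sum>j. b\<^sub>j c\<^sub>j)\<close>. Once \<open>y\<close> is known, \<open>w = W c\<close> can be solved coordinatewise:
  \<open>c\<^sub>i = w\<^sub>i / (1 + e\<^sub>i / y) = w\<^sub>i y / (y + e\<^sub>i)\<close>. Substituting this into the definition of \<open>y\<close>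
  gives exactly the equation \<open>R\<^sub>w(y) = 0\<close>. Hence \<open>W\<close> is bijective with the stated inverse as
  soon as \<open>R\<^sub>w\<close> has precisely one positive zero, and the inverse is as smooth as that zero is
  as a function of \<open>w\<close>.

  For \<open>y > 0\<close> the zeros of \<open>R\<^sub>w\<close> are those of
  \<open>H y w = R\<^sub>w(y) / y = 1 / y - 1 + (\<Sum>i. b\<^sub>i w\<^sub>i / (y + e\<^sub>i))\<close>, which on the orthant is visibly
  strictly decreasing in \<open>y\<close>. Continuous differentiability up to the boundary requires an
  extension beyond the orthant; the same formula provides it, because the term \<open>1 / y\<close> keeps
  \<open>H\<close> decreasing even when the coordinates \<open>w\<^sub>i\<close> are slightly negative. The open set \<open>nbhd\<close>
  quantifies this, and the zero \<open>rho w\<close> of \<open>H\<close> is defined on all of it.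

  Everything about \<open>rho\<close> comes from the exact identity \<open>H_diff\<close>, in which the increment of
  \<open>H\<close> is split into a part linear in the increment of \<open>w\<close> and the increment of \<open>y\<close> times a
  factor \<open>- slope\<close>, which is negative by \<open>slope_pos\<close>. For equal \<open>w\<close> it gives monotonicity, hence
  uniqueness of the zero and continuity of \<open>rho\<close>. Between two zeros it expresses
  \<open>rho v - rho w\<close> as a linear form in \<open>v - w\<close> divided by a continuous positive function, which
  gives the derivative of \<open>rho\<close> without an appeal to the implicit function theorem.
\<close>

section \<open>Two facts on differentiability\<close>

text \<open>Caratheodory's criterion: as \<open>L\<close> is bounded, replacing \<open>k v\<close> by \<open>k x\<close> changes the
  increment by \<open>o(norm (v - x))\<close>, for which continuity of \<open>k\<close> at \<open>x\<close> suffices.\<close>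

lemma has_derivative_continuous_factor:
  fixes f :: "'a::real_normed_vector \<Rightarrow> real"
  assumes L: "bounded_linear L" and k: "isCont k x"
    and eq: "\<forall>\<^sub>F v in at x. f v - f x = L (v - x) * k v"
  shows "(f has_derivative (\<lambda>h. L h * k x)) (at x)"
proof -
  interpret L: bounded_linear L by fact
  obtain K where K: "\<And>h. norm (L h) \<le> norm h * K" using L.bounded by blast
  have "((\<lambda>v. \<bar>k v - k x\<bar> * K) \<longlongrightarrow> 0) (at x)"
    using k unfolding isCont_def
    by (intro tendsto_mult_left_zero tendsto_rabs_zero LIM_zero)
  then have "((\<lambda>v. (f v - f x - L (v - x) * k x) /\<^sub>R norm (v - x)) \<longlongrightarrow> 0) (at x)"
  proof (rule Lim_null_comparison[rotated])
    show "\<forall>\<^sub>F v in at x. norm ((f v - f x - L (v - x) * k x) /\<^sub>R norm (v - x)) \<le> \<bar>k v - k x\<bar> * K"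
      using eq eventually_neq_at_within[of x x UNIV]
    proof eventually_elim
      case (elim v)
      have "norm ((f v - f x - L (v - x) * k x) /\<^sub>R norm (v - x))
          = \<bar>k v - k x\<bar> * (\<bar>L (v - x)\<bar> / norm (v - x))"
        by (simp add: elim(1) right_diff_distrib[symmetric] abs_mult divide_simps)
      also have "\<dots> \<le> \<bar>k v - k x\<bar> * K"
        using K[of "v - x"] elim(2) by (intro mult_left_mono) (auto simp: divide_simps mult_ac)
      finally show ?case .
    qed
  qed
  then show ?thesis
    by (intro has_derivativeI bounded_linear_mult_const L) simp_all
qed

lemma C1_up_to_boundary_cong:
  assumes "C1_up_to_boundary S f" "\<And>x. x \<in> S \<Longrightarrow> f x = g x"
  shows "C1_up_to_boundary S g"
proof -
  have "(\<forall>x\<in>S. h x = f x) \<longleftrightarrow> (\<forall>x\<in>S. h x = g x)" for h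
    using assms(2) by simp
  then show ?thesis
    using assms(1) unfolding C1_up_to_boundary_def by simp
qed

section \<open>The scalar equation\<close>

locale positive_coefficients =
  fixes e b :: "real^'n"
  assumes e_pos: "\<And>i. 0 < e $ i" and b_pos: "\<And>i. 0 < b $ i"
begin

definition H :: "real \<Rightarrow> real^'n \<Rightarrow> real" where
  "H y w = 1 / y - 1 + (\<Sum>i\<in>UNIV. b $ i * w $ i / (y + e $ i))"

text \<open>The negative of the difference quotient of \<open>H\<close> in its first argument, written without
  cancellation so that it also makes sense for \<open>y = z\<close>, where it is \<open>- \<partial>H / \<partial>y\<close>.\<close>
definition slope :: "real \<Rightarrow> real \<Rightarrow> real^'n \<Rightarrow> real" where
  "slope y z w = 1 / (y * z) + (\<Sum>i\<in>UNIV. b $ i * w $ i / ((y + e $ i) * (z + e $ i)))"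

text \<open>With all \<open>n\<close> products \<open>b\<^sub>i w\<^sub>i\<close> above \<open>-1 / (2 n)\<close>, their negative parts sum to less than
  one half. Asking for one half rather than one leaves room for the explicit lower bound
  \<open>1 / 2\<close> on the zero of \<open>H\<close>.\<close>
definition nbhd :: "(real^'n) set" where
  "nbhd = {w. \<forall>i. - (1 / (2 * real CARD('n))) < b $ i * w $ i}"

definition rho :: "real^'n \<Rightarrow> real" where
  "rho w = (THE y. 0 < y \<and> H y w = 0)"

lemma add_e_pos: "0 < y + e $ i" if "0 < y"
  using e_pos[of i] that by simp

lemma add_e_nz: "y + e $ i \<noteq> 0" if "0 < y"
  using add_e_pos[OF that, of i] by simp

lemma quotient_bounds: "0 \<le> y / (y + e $ i)" "y / (y + e $ i) \<le> 1" if "0 < y"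
  using add_e_pos[OF that, of i] e_pos[of i] that by auto

lemma open_nbhd: "open nbhd"
proof -
  have "nbhd = (\<Inter>i. {w. - (1 / (2 * real CARD('n))) < b $ i * w $ i})"
    by (auto simp: nbhd_def)
  then show ?thesis
    by (simp only:) (intro open_INT ballI open_Collect_less continuous_intros finite_class.finite_UNIV)
qed

lemma orthant_subset_nbhd: "orthant \<subseteq> nbhd"
proof
  fix w :: "real^'n" assume w: "w \<in> orthant"
  have "- (1 / (2 * real CARD('n))) < b $ i * w $ i" for i
  proof -
    have "0 \<le> b $ i * w $ i"
      using w b_pos[of i] by (simp add: orthant_def)
    moreover have "0 < 1 / (2 * real CARD('n))"
      by simp
    ultimately show ?thesis
      by linarith
  qed
  then show "w \<in> nbhd" by (simp add: nbhd_def)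
qed

text \<open>This is the one place where the size of \<open>nbhd\<close> enters: it makes the contribution \<open>1 / y\<close>
  to \<open>H\<close>, and \<open>1 / (y * z)\<close> to \<open>slope\<close>, dominate the possibly negative terms of the sums.
  After multiplication by \<open>y\<close> or \<open>y * z\<close> these terms carry the weights \<open>y / (y + e $ i)\<close> or
  products of two such weights, all in the unit interval.\<close>
lemma weighted_sum_gt:
  assumes w: "w \<in> nbhd" and t: "\<And>i. 0 \<le> t i" "\<And>i. t i \<le> 1"
  shows "1 / 2 < 1 + (\<Sum>i\<in>UNIV. b $ i * w $ i * t i)"
proof -
  have "(\<Sum>i\<in>(UNIV :: 'n set). - (1 / (2 * real CARD('n)))) < (\<Sum>i\<in>UNIV. b $ i * w $ i * t i)"
  proof (rule sum_strict_mono)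
    fix i :: 'n
    let ?k = "1 / (2 * real CARD('n))"
    have k: "0 < ?k" by simp
    have w: "- ?k < b $ i * w $ i"
      using w by (simp add: nbhd_def)
    show "- ?k < b $ i * w $ i * t i"
    proof (cases "t i = 0")
      case False
      then have "0 < t i" using t(1)[of i] by simp
      then have "- ?k * t i < b $ i * w $ i * t i"
        using w by (rule mult_strict_right_mono[rotated])
      moreover have "?k * t i \<le> ?k * 1"
        using k t(2) by (intro mult_left_mono) auto
      ultimately show ?thesis by linarith
    qed (use k in simp)
  qed auto
  then show ?thesis by simp
qed

text \<open>The increment is taken first in \<open>w\<close> at fixed \<open>y\<close>, where \<open>H\<close> is affine, and then in \<open>y\<close> at
  fixed \<open>v\<close>, where \<open>1 / (z + d) - 1 / (y + d) = - (z - y) / ((y + d) * (z + d))\<close> holds for each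
  term.\<close>
lemma H_diff:
  assumes "0 < y" "0 < z"
  shows "H z v - H y w = (\<Sum>i\<in>UNIV. b $ i * (v - w) $ i / (y + e $ i)) - (z - y) * slope y z v"
proof -
  have 1: "1 / z - 1 / y = - (z - y) * (1 / (y * z))"
    using assms by (simp add: field_simps)
  have 2: "b $ i * v $ i / (z + e $ i) - b $ i * w $ i / (y + e $ i)
      = b $ i * (v - w) $ i / (y + e $ i)
        - (z - y) * (b $ i * v $ i / ((y + e $ i) * (z + e $ i)))" for i
    using add_e_nz[OF assms(1), of i] add_e_nz[OF assms(2), of i]
    by (simp add: divide_simps) algebra
  have "H z v - H y w = (1 / z - 1 / y)
      + (\<Sum>i\<in>UNIV. b $ i * v $ i / (z + e $ i) - b $ i * w $ i / (y + e $ i))"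
    by (simp add: H_def sum_subtractf)
  also have "\<dots> = - (z - y) * (1 / (y * z)) + ((\<Sum>i\<in>UNIV. b $ i * (v - w) $ i / (y + e $ i))
        - (z - y) * (\<Sum>i\<in>UNIV. b $ i * v $ i / ((y + e $ i) * (z + e $ i))))"
    by (simp only: 1 2 sum_subtractf sum_distrib_left)
  finally show ?thesis
    unfolding slope_def distrib_left by linarith
qed

lemma slope_pos:
  assumes "w \<in> nbhd" "0 < y" "0 < z"
  shows "0 < slope y z w"
proof -
  let ?t = "\<lambda>i. (y / (y + e $ i)) * (z / (z + e $ i))"
  have "1 / 2 < 1 + (\<Sum>i\<in>UNIV. b $ i * w $ i * ?t i)"
    using assms by (intro weighted_sum_gt mult_nonneg_nonneg mult_le_one quotient_bounds) auto
  also have "\<dots> = y * z * slope y z w"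
    using assms by (simp add: slope_def distrib_left sum_distrib_left mult_ac)
  finally have "0 < (y * z) * slope y z w" by simp
  then show ?thesis
    using assms(2,3) by (rule zero_less_mult_pos[OF _ mult_pos_pos])
qed

lemma H_strict_decreasing:
  assumes "w \<in> nbhd" "0 < y" "y < z"
  shows "H z w < H y w"
proof -
  have "0 < (z - y) * slope y z w"
    using slope_pos[of w y z] assms by (intro mult_pos_pos) auto
  then show ?thesis
    using H_diff[of y z w w] assms by simp
qed

lemma H_low: "0 \<le> H (1/2) w" if "w \<in> nbhd"
proof -
  let ?t = "\<lambda>i. (1/2) / (1/2 + e $ i)"
  have "1 / 2 < 1 + (\<Sum>i\<in>UNIV. b $ i * w $ i * ?t i)"
    by (intro weighted_sum_gt that quotient_bounds) auto
  also have "\<dots> = (1/2) * H (1/2) w + 1/2"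
    by (simp add: H_def distrib_left sum_distrib_left mult_ac)
  finally show ?thesis by simp
qed

text \<open>For this \<open>Y\<close> the sum in \<open>H Y w\<close> is at most \<open>(Y - 1) / Y = 1 - 1 / Y\<close>.\<close>
lemma H_high: "H (1 + (\<Sum>i\<in>UNIV. \<bar>b $ i * w $ i\<bar>)) w \<le> 0"
proof -
  define Y where "Y = 1 + (\<Sum>i\<in>UNIV. \<bar>b $ i * w $ i\<bar>)"
  have Y: "0 < Y" unfolding Y_def by (simp add: add_pos_nonneg sum_nonneg)
  have "b $ i * w $ i / (Y + e $ i) \<le> \<bar>b $ i * w $ i\<bar> / Y" for i
  proof -
    have "b $ i * w $ i / (Y + e $ i) \<le> \<bar>b $ i * w $ i\<bar> / (Y + e $ i)"
      using add_e_pos[OF Y, of i] by (intro divide_right_mono) auto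
    also have "\<dots> \<le> \<bar>b $ i * w $ i\<bar> / Y"
      using Y e_pos[of i] by (intro divide_left_mono) (auto simp: add_pos_pos)
    finally show ?thesis .
  qed
  then have "H Y w \<le> 1 / Y - 1 + (\<Sum>i\<in>UNIV. \<bar>b $ i * w $ i\<bar> / Y)"
    unfolding H_def by (intro add_left_mono sum_mono)
  also have "\<dots> = 1 / Y - 1 + (Y - 1) / Y"
    by (simp add: Y_def sum_divide_distrib)
  also have "\<dots> = 0"
    using Y by (simp add: field_simps)
  finally show ?thesis by (simp add: Y_def)
qed

lemma ex1_zero:
  assumes w: "w \<in> nbhd"
  shows "\<exists>!y. 0 < y \<and> H y w = 0"
proof (rule ex_ex1I)
  let ?Y = "1 + (\<Sum>i\<in>UNIV. \<bar>b $ i * w $ i\<bar>)"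
  have "continuous_on {1/2..?Y} (\<lambda>y. H y w)"
    unfolding H_def using add_e_nz by (intro continuous_intros ballI) fastforce+
  moreover have "1/2 \<le> ?Y"
    by (rule order_trans[of _ 1]) (auto intro: sum_nonneg)
  ultimately obtain y where "1/2 \<le> y" "H y w = 0"
    using IVT2'[of "\<lambda>y. H y w" ?Y 0 "1/2"] H_low[OF w] H_high by blast
  then show "\<exists>y. 0 < y \<and> H y w = 0"
    by (intro exI[of _ y]) auto
next
  fix y z assume "0 < y \<and> H y w = 0" "0 < z \<and> H z w = 0"
  then show "y = z"
    using H_strict_decreasing[OF w, of y z] H_strict_decreasing[OF w, of z y]
    by (cases y z rule: linorder_cases) auto
qed

lemma
  assumes "w \<in> nbhd"
  shows rho_pos: "0 < rho w" and H_rho: "H (rho w) w = 0"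
  unfolding rho_def using theI'[OF ex1_zero[OF assms]] by blast+

lemma rho_eqI: "rho w = y" if "w \<in> nbhd" "0 < y" "H y w = 0"
  unfolding rho_def using that by (intro the1_equality ex1_zero conjI)

text \<open>For \<open>y < rho w < z\<close> the signs \<open>H y w > 0 > H z w\<close> are strict, so they persist when \<open>w\<close> is
  moved a little, and by monotonicity they still trap the zero between \<open>y\<close> and \<open>z\<close>.\<close>
lemma isCont_rho:
  assumes w: "w \<in> nbhd"
  shows "isCont rho w"
  unfolding isCont_def
proof (rule order_tendstoI)
  have H: "((\<lambda>v. H y v) \<longlongrightarrow> H y w) (at w)" if "0 < y" for y
    unfolding H_def using add_e_nz[OF that] by (auto intro!: tendsto_intros)
  have ev: "\<forall>\<^sub>F v in at w. v \<in> nbhd"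
    using eventually_nhds_in_open[OF open_nbhd w] by (simp add: eventually_nhds_conv_at)
  fix y
  {
    assume y: "y < rho w"
    \<comment> \<open>\<open>y\<close> may be nonpositive, where \<open>H\<close> carries no information, so a positive point between
      \<open>y\<close> and \<open>rho w\<close> takes its place.\<close>
    define z where "z = max y (rho w / 2)"
    have z: "0 < z" "z < rho w" "y \<le> z"
      using y rho_pos[OF w] by (auto simp: z_def)
    have "0 < H z w"
      using H_strict_decreasing[OF w z(1,2)] H_rho[OF w] by simp
    then have "\<forall>\<^sub>F v in at w. 0 < H z v"
      by (rule order_tendstoD(1)[OF H[OF z(1)]])
    with ev show "\<forall>\<^sub>F v in at w. y < rho v"
    proof eventually_elim
      case (elim v)
      then have "\<not> rho v \<le> z"
        using H_strict_decreasing[of v "rho v" z] rho_pos[of v] H_rho[of v]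
        by (cases "rho v = z") auto
      then show ?case using z by simp
    qed
  next
    assume y: "rho w < y"
    then have y0: "0 < y" using rho_pos[OF w] by simp
    have "H y w < 0"
      using H_strict_decreasing[OF w rho_pos[OF w] y] H_rho[OF w] by simp
    then have "\<forall>\<^sub>F v in at w. H y v < 0"
      by (rule order_tendstoD(2)[OF H[OF y0]])
    with ev show "\<forall>\<^sub>F v in at w. rho v < y"
    proof eventually_elim
      case (elim v)
      then show ?case
        using H_strict_decreasing[of v y "rho v"] y0 H_rho[of v]
        by (cases y "rho v" rule: linorder_cases) auto
    qed
  }
qed

lemma continuous_on_rho: "continuous_on nbhd rho"
  by (simp add: continuous_at_imp_continuous_on isCont_rho)

section \<open>Differentiability of the inverse\<close>

definition rho_deriv :: "real^'n \<Rightarrow> real^'n \<Rightarrow> real" where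
  "rho_deriv w h = (\<Sum>i\<in>UNIV. b $ i * h $ i / (rho w + e $ i)) / slope (rho w) (rho w) w"

text \<open>At two zeros the left-hand side of \<open>H_diff\<close> vanishes, so \<open>rho v - rho w\<close> is a fixed linear
  form in \<open>v - w\<close> times \<open>1 / slope (rho w) (rho v) v\<close>, a continuous function of \<open>v\<close>.\<close>
lemma rho_has_derivative:
  assumes w: "w \<in> nbhd"
  shows "(rho has_derivative rho_deriv w) (at w)"
proof -
  let ?L = "\<lambda>h. \<Sum>i\<in>UNIV. b $ i * h $ i / (rho w + e $ i)"
  have "(rho has_derivative (\<lambda>h. ?L h * (1 / slope (rho w) (rho w) w))) (at w)"
  proof (rule has_derivative_continuous_factor[where k = "\<lambda>v. 1 / slope (rho w) (rho v) v"])
    show "bounded_linear ?L"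
      unfolding divide_inverse
      by (intro bounded_linear_sum bounded_linear_mult_const bounded_linear_const_mult bounded_linear_vec_nth)
    have nz: "rho w + e $ i \<noteq> 0" for i
      using add_e_nz rho_pos w by blast
    show "isCont (\<lambda>v. 1 / slope (rho w) (rho v) v) w"
      using slope_pos[OF w rho_pos[OF w] rho_pos[OF w]] rho_pos[OF w] nz unfolding slope_def
      by (intro continuous_intros isCont_rho[OF w]) auto
    show "\<forall>\<^sub>F v in at w. rho v - rho w = ?L (v - w) * (1 / slope (rho w) (rho v) v)"
    proof -
      have "rho v - rho w = ?L (v - w) * (1 / slope (rho w) (rho v) v)" if "v \<in> nbhd" for v
        using H_diff[OF rho_pos[OF w] rho_pos[OF that], of v w] H_rho[OF w] H_rho[OF that]
          slope_pos[OF that rho_pos[OF w] rho_pos[OF that]]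
        by (simp add: nonzero_eq_divide_eq)
      then show ?thesis
        using open_nbhd w by (auto simp: eventually_at_topological)
    qed
  qed
  then show ?thesis by (simp add: rho_deriv_def[abs_def])
qed

definition backward :: "real^'n \<Rightarrow> real^'n" where
  "backward w = (\<chi> i. w $ i / (1 + e $ i / rho w))"

lemma backward_nth:
  assumes "w \<in> nbhd"
  shows "backward w $ i = w $ i * (rho w / (rho w + e $ i))"
  using rho_pos[OF assms] add_e_nz[OF rho_pos[OF assms], of i]
  by (simp add: backward_def field_simps)

definition backward_deriv :: "real^'n \<Rightarrow> real^'n \<Rightarrow> real^'n" where
  "backward_deriv w h = (\<chi> i. h $ i * (rho w / (rho w + e $ i))
     + w $ i * (e $ i / (rho w + e $ i)\<^sup>2 * rho_deriv w h))"

lemma backward_has_derivative: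
  assumes w: "w \<in> nbhd"
  shows "(backward has_derivative backward_deriv w) (at w)"
proof -
  have nz: "rho w + e $ i \<noteq> 0" for i
    using add_e_nz rho_pos w by blast
  have r: "((\<lambda>v. v $ i * (rho v / (rho v + e $ i))) has_derivative
      (\<lambda>h. backward_deriv w h $ i)) (at w)" for i
  proof -
    have "((\<lambda>y. y / (y + e $ i)) has_real_derivative e $ i / (rho w + e $ i)\<^sup>2) (at (rho w))"
      using nz[of i] by (auto intro!: derivative_eq_intros simp: power2_eq_square)
    from DERIV_compose_FDERIV[OF this rho_has_derivative[OF w]]
    have "((\<lambda>v. rho v / (rho v + e $ i)) has_derivative
        (\<lambda>h. rho_deriv w h * (e $ i / (rho w + e $ i)\<^sup>2))) (at w)" .
    from has_derivative_mult[OF bounded_linear_imp_has_derivative[OF bounded_linear_vec_nth] this]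
    show ?thesis
      by (simp add: backward_deriv_def add.commute mult.commute)
  qed
  have "((\<lambda>v. \<chi> i. v $ i * (rho v / (rho v + e $ i))) has_derivative backward_deriv w) (at w)"
    by (subst has_derivative_componentwise_within)
       (use r in \<open>auto simp: Basis_vec_def inner_axis\<close>)
  then show ?thesis
    by (rule has_derivative_transform_within_open[OF _ open_nbhd w])
       (simp add: vec_eq_iff backward_nth)
qed

lemma continuous_on_backward_deriv: "continuous_on nbhd (\<lambda>w. backward_deriv w h)"
proof -
  have "rho w \<noteq> 0" "rho w + e $ i \<noteq> 0" "slope (rho w) (rho w) w \<noteq> 0" if "w \<in> nbhd" for w i
    using rho_pos[OF that] add_e_nz[OF rho_pos[OF that]]
      slope_pos[OF that rho_pos[OF that] rho_pos[OF that]] by auto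
  then show ?thesis
    unfolding backward_deriv_def rho_deriv_def slope_def
    by (intro continuous_intros continuous_on_rho) auto
qed

text \<open>In finite dimension, continuity of the derivative in the operator norm only has to be
  checked on each basis vector.\<close>
lemma C1_backward: "C1_up_to_boundary orthant backward"
proof -
  have bl: "bounded_linear (backward_deriv w)" if "w \<in> nbhd" for w
    using backward_has_derivative[OF that] by (rule has_derivative_bounded_linear)
  have "continuous_on nbhd (\<lambda>w. Blinfun (backward_deriv w))"
  proof (rule continuous_on_blinfun_componentwise)
    fix h :: "real^'n" assume "h \<in> Basis"
    show "continuous_on nbhd (\<lambda>w. blinfun_apply (Blinfun (backward_deriv w)) h)"
      by (rule continuous_on_eq[OF continuous_on_backward_deriv[of h]])
         (simp add: bounded_linear_Blinfun_apply bl)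
  qed
  then show ?thesis
    unfolding C1_up_to_boundary_def
    by (intro exI[of _ nbhd] exI[of _ backward] exI[of _ "\<lambda>w. Blinfun (backward_deriv w)"])
       (auto simp: open_nbhd orthant_subset_nbhd[THEN subsetD] bounded_linear_Blinfun_apply bl
          backward_has_derivative)
qed

section \<open>Bijectivity on the orthant\<close>

definition forward :: "real^'n \<Rightarrow> real^'n" where
  "forward c = (\<chi> i. c $ i * (1 + e $ i / (1 + (\<Sum>j\<in>UNIV. b $ j * c $ j))))"

lemma total_pos: "0 < 1 + (\<Sum>j\<in>UNIV. b $ j * c $ j)" if "c \<in> orthant"
  using that b_pos[THEN less_imp_le] by (intro add_pos_nonneg sum_nonneg) (auto simp: orthant_def)

lemma forward_in_orthant: "forward c \<in> orthant" if "c \<in> orthant"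
proof -
  have "0 \<le> e $ i / (1 + (\<Sum>j\<in>UNIV. b $ j * c $ j))" for i
    using total_pos[OF that] e_pos[of i] by simp
  then show ?thesis
    using that by (auto simp: orthant_def forward_def intro!: mult_nonneg_nonneg add_nonneg_nonneg)
qed

lemma backward_in_orthant: "backward w \<in> orthant" if "w \<in> orthant"
  using that rho_pos[of w] orthant_subset_nbhd e_pos[THEN less_imp_le]
  by (fastforce simp: orthant_def backward_def intro!: divide_nonneg_nonneg add_nonneg_nonneg)

text \<open>Since \<open>forward c $ i = c $ i * (y + e $ i) / y\<close> for \<open>y = 1 + (\<Sum>j. b\<^sub>j c\<^sub>j)\<close>, the denominators in
  \<open>H y (forward c)\<close> cancel and leave \<open>1 / y - 1 + (y - 1) / y = 0\<close>.\<close>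
lemma rho_forward:
  assumes c: "c \<in> orthant"
  shows "rho (forward c) = 1 + (\<Sum>j\<in>UNIV. b $ j * c $ j)"
proof (rule rho_eqI)
  define y where "y = 1 + (\<Sum>j\<in>UNIV. b $ j * c $ j)"
  show "forward c \<in> nbhd"
    using forward_in_orthant[OF c] orthant_subset_nbhd by blast
  show y: "0 < 1 + (\<Sum>j\<in>UNIV. b $ j * c $ j)"
    by (rule total_pos[OF c])
  have "b $ i * forward c $ i / (y + e $ i) = b $ i * c $ i / y" for i
    using y add_e_nz[of y i] unfolding forward_def y_def[symmetric] by (simp add: divide_simps)
  then have "H y (forward c) = 1 / y - 1 + (y - 1) / y"
    by (simp add: H_def y_def sum_divide_distrib)
  also have "\<dots> = 0"
    using y unfolding y_def[symmetric] by (simp add: field_simps)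
  finally show "H (1 + (\<Sum>j\<in>UNIV. b $ j * c $ j)) (forward c) = 0"
    by (simp add: y_def)
qed

lemma backward_forward: "backward (forward c) = c" if "c \<in> orthant"
proof -
  define y where "y = 1 + (\<Sum>j\<in>UNIV. b $ j * c $ j)"
  have "1 + e $ i / y \<noteq> 0" for i
    using total_pos[OF that] e_pos[of i] by (simp add: y_def add_pos_pos less_imp_neq[symmetric])
  then show ?thesis
    using rho_forward[OF that] by (simp add: vec_eq_iff backward_def forward_def y_def)
qed

text \<open>This is the equation \<open>H (rho w) w = 0\<close> multiplied by \<open>rho w\<close>; it identifies the denominator
  that \<open>forward\<close> sees at \<open>backward w\<close>.\<close>
lemma total_backward:
  assumes "w \<in> nbhd"
  shows "1 + (\<Sum>j\<in>UNIV. b $ j * backward w $ j) = rho w"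
proof -
  have "(\<Sum>j\<in>UNIV. b $ j * backward w $ j) = rho w * (\<Sum>j\<in>UNIV. b $ j * w $ j / (rho w + e $ j))"
    by (simp add: backward_nth[OF assms] sum_distrib_left mult_ac)
  also have "\<dots> = rho w * (1 - 1 / rho w)"
    using H_rho[OF assms] by (simp add: H_def)
  also have "\<dots> = rho w - 1"
    using rho_pos[OF assms] by (simp add: field_simps)
  finally show ?thesis by simp
qed

lemma forward_backward: "forward (backward w) = w" if "w \<in> nbhd"
proof -
  have "1 + e $ i / rho w \<noteq> 0" for i
    using rho_pos[OF that] e_pos[of i] by (simp add: add_pos_pos less_imp_neq[symmetric])
  then show ?thesis
    by (simp add: vec_eq_iff forward_def total_backward[OF that]) (simp add: backward_def)
qed

lemma bij_betw_forward: "bij_betw forward orthant orthant"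
  by (rule bij_betw_byWitness[of _ backward])
     (use orthant_subset_nbhd in \<open>auto intro: backward_forward forward_backward
        forward_in_orthant backward_in_orthant\<close>)

lemma inv_into_forward: "inv_into orthant forward w = backward w" if "w \<in> orthant"
proof (rule inv_into_f_eq)
  show "inj_on forward orthant"
    using bij_betw_forward by (rule bij_betw_imp_inj_on)
  show "backward w \<in> orthant"
    using that by (rule backward_in_orthant)
  show "forward (backward w) = w"
    using that orthant_subset_nbhd by (blast intro: forward_backward)
qed

end

section \<open>The inverse of \<open>W\<close>\<close>

theorem theorem2p2:
  fixes a b :: "real ^ 'n::{finite,linorder}" and \<epsilon> :: real
  assumes "0 < \<epsilon>" and "\<epsilon> < 1"
    and "\<And>i. 0 < a $ i" and "strict_mono (\<lambda>i. a $ i)"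
    and "\<And>i. 0 < b $ i"
  shows "bij_betw (W \<epsilon> a b) orthant orthant \<and>
    C1_up_to_boundary orthant (inv_into orthant (W \<epsilon> a b)) \<and>
    (\<forall>w\<in>orthant.
       (\<exists>!y. 0 < y \<and> R \<epsilon> a b w y = 0) \<and>
       (\<forall>i. inv_into orthant (W \<epsilon> a b) w $ i = w $ i / (1 + eta \<epsilon> a $ i / rho0 \<epsilon> a b w)))"
proof -
  interpret positive_coefficients "eta \<epsilon> a" b
    using assms by unfold_locales (auto simp: eta_def)
  have W: "W \<epsilon> a b = forward"
    by (simp add: fun_eq_iff W_def forward_def)
  \<comment> \<open>\<open>R\<close> and \<open>H\<close> differ by the factor \<open>y\<close>, so \<open>rho0\<close> and \<open>rho\<close> select the same zero.\<close>
  have "R \<epsilon> a b w y = y * H y w" if "0 < y" for w y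
    using that by (simp add: R_def H_def algebra_simps sum_distrib_left)
  then have root_iff: "0 < y \<and> R \<epsilon> a b w y = 0 \<longleftrightarrow> 0 < y \<and> H y w = 0" for w y
    by auto
  have "C1_up_to_boundary orthant (inv_into orthant forward)"
    by (rule C1_up_to_boundary_cong[OF C1_backward]) (simp add: inv_into_forward)
  then show ?thesis
    unfolding W rho0_def root_iff rho_def[symmetric]
    using bij_betw_forward ex1_zero[OF orthant_subset_nbhd[THEN subsetD]]
    by (simp add: inv_into_forward backward_def)
qed

end
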